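(* For every integer $n \ge 1$, $T_n \cap A_n = D_n$.
   Context: Let $F_n$ be the free group on $x_1,\ldots,x_n$, with endomorphism set $\mathrm{End}(F_n)$ and automorphism group $\mathrm{Aut}(F_n)$. For $w\in F_n$ and a group $G$, the word map of $w$ on $G$ is the map $G^n\to G$, $(g_1,\ldots,g_n)\mapsto w(g_1,\ldots,g_n)$, obtained by substituting $g_i$ for $x_i$ in $w$; its image is denoted $G_w$. A word $w\in F_n$ is achiral if $G_w=G_{w^{-1}}$ for every group $G$, and chiral otherwise. Let $A_n=\{w\in F_n : w \text{ is achiral}\}$. For $w\in F_n$ let $\mathrm{End}_w=\{f\in \mathrm{End}(F_n): f(w)=w^{-1}\}$ and $\mathrm{Aut}_w=\{f\in \mathrm{Aut}(F_n): f(w)=w^{-1}\}$. Let $D_n=\{w\in A_n: \mathrm{End}_w=\mathrm{Aut}_w\}$. A word $w\in F_n$ is a test word if every endomorphism of $F_n$ that fixes $w$ is an automorphism; $T_n$ denotes the set of all test words of $F_n$, i.e. $T_n=\{w\in F_n : \text{for all } \sigma\in\mathrm{End}(F_n),\ \sigma(w)=w \Rightarrow \sigma\in \mathrm{Aut}(F_n)\}$. *)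

theory Defs
  imports "HOL-Algebra.Coset" "HOL-Library.Countable_Set" "HOL-Library.Infinite_Typeclass"
begin

text \<open>The letter \<open>(x, True)\<close> stands for the generator \<open>x\<close>, the letter \<open>(x, False)\<close> for its inverse.
  The free group is realised on the reduced words.\<close>

type_synonym 'a word = "('a \<times> bool) list"

definition inv_letter :: "'a \<times> bool \<Rightarrow> 'a \<times> bool" where
  "inv_letter a = (fst a, \<not> snd a)"

definition reduced :: "'a word \<Rightarrow> bool" where
  "reduced w \<longleftrightarrow> successively (\<lambda>a b. b \<noteq> inv_letter a) w"

fun push :: "'a \<times> bool \<Rightarrow> 'a word \<Rightarrow> 'a word" where
  "push a [] = [a]"
| "push a (b # w) = (if b = inv_letter a then w else a # b # w)"

definition free_group :: "'a set \<Rightarrow> 'a word monoid" where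
  "free_group X =
    \<lparr>carrier = {w. reduced w \<and> fst ` set w \<subseteq> X}, mult = foldr push, one = []\<rparr>"

fun word_eval :: "('g, 'm) monoid_scheme \<Rightarrow> ('a \<Rightarrow> 'g) \<Rightarrow> 'a word \<Rightarrow> 'g" where
  "word_eval G g [] = \<one>\<^bsub>G\<^esub>"
| "word_eval G g (a # w) =
    (if snd a then g (fst a) else inv\<^bsub>G\<^esub> g (fst a)) \<otimes>\<^bsub>G\<^esub> word_eval G g w"

abbreviation FG :: "nat \<Rightarrow> nat word monoid" where
  "FG n \<equiv> free_group {1..n}"

definition word_map :: "nat \<Rightarrow> ('g, 'm) monoid_scheme \<Rightarrow> nat word \<Rightarrow> (nat \<Rightarrow> 'g) \<Rightarrow> 'g" where
  "word_map n G w = (\<lambda>g \<in> {1..n} \<rightarrow>\<^sub>E carrier G. word_eval G g w)"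

definition word_image :: "nat \<Rightarrow> ('g, 'm) monoid_scheme \<Rightarrow> nat word \<Rightarrow> 'g set" where
  "word_image n G w = word_map n G w ` ({1..n} \<rightarrow>\<^sub>E carrier G)"

text \<open>HOL cannot quantify over groups of all types inside a definition, so achirality takes
  the type \<open>'g\<close> of group elements as a parameter. As soon as \<open>'g\<close> is infinite,
  the notion does not depend on it: lemma \<open>achiral_all_groups\<close> below derives the
  equality of images in every group over every type.  (Over a finite type only finite groups
  would be tested.)\<close>

definition achiral :: "'g itself \<Rightarrow> nat \<Rightarrow> nat word \<Rightarrow> bool" where
  "achiral TYPE('g) n w \<longleftrightarrow>
    (\<forall>G :: 'g monoid. group G \<longrightarrow> word_image n G w = word_image n G (inv\<^bsub>FG n\<^esub> w))"

definition achiral_words :: "'g itself \<Rightarrow> nat \<Rightarrow> nat word set" where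
  "achiral_words TYPE('g) n = {w \<in> carrier (FG n). achiral TYPE('g) n w}"

definition End_inv :: "nat \<Rightarrow> nat word \<Rightarrow> (nat word \<Rightarrow> nat word) set" where
  "End_inv n w = {f \<in> hom (FG n) (FG n). f w = inv\<^bsub>FG n\<^esub> w}"

definition Aut_inv :: "nat \<Rightarrow> nat word \<Rightarrow> (nat word \<Rightarrow> nat word) set" where
  "Aut_inv n w = {f \<in> iso (FG n) (FG n). f w = inv\<^bsub>FG n\<^esub> w}"

definition D_words :: "'g itself \<Rightarrow> nat \<Rightarrow> nat word set" where
  "D_words TYPE('g) n = {w \<in> achiral_words TYPE('g) n. End_inv n w = Aut_inv n w}"

definition test_words :: "nat \<Rightarrow> nat word set" where
  "test_words n = {w \<in> carrier (FG n). \<forall>\<sigma> \<in> hom (FG n) (FG n). \<sigma> w = w \<longrightarrow> \<sigma> \<in> iso (FG n) (FG n)}"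


subsection \<open>The free group and its universal property\<close>

lemma inv_letter_inv_letter [simp]: "inv_letter (inv_letter a) = a"
  by (simp add: inv_letter_def)

lemma fst_inv_letter [simp]: "fst (inv_letter a) = fst a"
  by (simp add: inv_letter_def)

lemma inv_letter_neq: "inv_letter a \<noteq> a"
  by (cases a) (simp add: inv_letter_def)

lemma reduced_Cons_D: "reduced (a # w) \<Longrightarrow> reduced w"
  by (cases w) (auto simp: reduced_def)

lemma reduced_push: "reduced w \<Longrightarrow> reduced (push a w)"
  by (cases w) (auto simp: reduced_def successively_Cons)

lemma set_push: "set (push a w) \<subseteq> insert a (set w)"
  by (cases w) auto

lemma push_reduced: "reduced (a # w) \<Longrightarrow> push a w = a # w"
  by (cases w) (auto simp: reduced_def)

lemma push_inv_letter: "reduced w \<Longrightarrow> push (inv_letter a) (push a w) = w"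
  by (cases w; cases "tl w") (auto simp: reduced_def)

lemma push_inv_letter': "reduced w \<Longrightarrow> push a (push (inv_letter a) w) = w"
  using push_inv_letter[of w "inv_letter a"] by simp

lemma reduced_foldr_push: "reduced w \<Longrightarrow> reduced (foldr push v w)"
  by (induction v) (auto intro: reduced_push)

lemma set_foldr_push: "set (foldr push v w) \<subseteq> set v \<union> set w"
proof (induction v)
  case (Cons a v)
  then show ?case using set_push[of a "foldr push v w"] by auto
qed simp

lemma foldr_push_push:
  "reduced w \<Longrightarrow> foldr push (push a u) w = push a (foldr push u w)"
  by (cases u) (auto simp: push_inv_letter' reduced_foldr_push)

lemma foldr_push_assoc:
  "reduced w \<Longrightarrow> foldr push (foldr push u v) w = foldr push u (foldr push v w)"
  by (induction u) (auto simp: foldr_push_push)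

lemma foldr_push_Nil: "reduced w \<Longrightarrow> foldr push w [] = w"
proof (induction w)
  case (Cons a w)
  then have "foldr push w [] = w" by (blast dest: reduced_Cons_D)
  with Cons.prems show ?case by (simp add: push_reduced)
qed simp

lemma reduced_Nil [simp]: "reduced []"
  by (simp add: reduced_def)

lemma foldr_push_inverse:
  "reduced w \<Longrightarrow> foldr push (map inv_letter (rev v)) (foldr push v w) = w"
  by (induction v arbitrary: w) (auto simp: push_inv_letter reduced_foldr_push)

lemma group_free_group: "group (free_group X)"
proof (rule groupI)
  fix u assume u: "u \<in> carrier (free_group X)"
  let ?v = "foldr push (map inv_letter (rev u)) []"
  have "set ?v \<subseteq> inv_letter ` set u"
    using set_foldr_push[of "map inv_letter (rev u)" "[]"] by simp
  then have "?v \<in> carrier (free_group X)"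
    using u by (fastforce simp: free_group_def intro: reduced_foldr_push)
  moreover have "?v \<otimes>\<^bsub>free_group X\<^esub> u = \<one>\<^bsub>free_group X\<^esub>"
    using u foldr_push_inverse[of "[]" u]
    by (simp add: free_group_def foldr_push_assoc foldr_push_Nil)
  ultimately show "\<exists>v \<in> carrier (free_group X). v \<otimes>\<^bsub>free_group X\<^esub> u = \<one>\<^bsub>free_group X\<^esub>"
    by blast
next
  fix u v assume "u \<in> carrier (free_group X)" "v \<in> carrier (free_group X)"
  then show "u \<otimes>\<^bsub>free_group X\<^esub> v \<in> carrier (free_group X)"
    using set_foldr_push[of u v] by (fastforce simp: free_group_def intro: reduced_foldr_push)
qed (auto simp: free_group_def foldr_push_assoc)

lemma generator_in_free_group: "x \<in> X \<Longrightarrow> [(x, True)] \<in> carrier (free_group X)"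
  by (simp add: free_group_def reduced_def)

context group
begin

lemma word_eval_closed:
  "g \<in> X \<rightarrow> carrier G \<Longrightarrow> fst ` set w \<subseteq> X \<Longrightarrow> word_eval G g w \<in> carrier G"
  by (induction w) (auto simp: Pi_iff)

lemma word_eval_push:
  assumes "g \<in> X \<rightarrow> carrier G" "fst a \<in> X" "fst ` set w \<subseteq> X"
  shows "word_eval G g (push a w) = word_eval G g (a # w)"
proof (cases w)
  case (Cons b v)
  have "g (fst a) \<in> carrier G" using assms by auto
  moreover have "word_eval G g v \<in> carrier G"
    using assms Cons by (intro word_eval_closed[of g X]) auto
  ultimately show ?thesis
    using Cons by (auto simp: inv_letter_def inv_solve_left m_assoc[symmetric])
qed simp

lemma word_eval_hom:
  assumes g: "g \<in> X \<rightarrow> carrier G"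
  shows "word_eval G g \<in> hom (free_group X) G"
proof (rule homI)
  fix u v assume "u \<in> carrier (free_group X)" and v: "v \<in> carrier (free_group X)"
  then have "fst ` set u \<subseteq> X" and v: "fst ` set v \<subseteq> X" by (auto simp: free_group_def)
  then show "word_eval G g (u \<otimes>\<^bsub>free_group X\<^esub> v) = word_eval G g u \<otimes> word_eval G g v"
  proof (induction u)
    case Nil
    then show ?case using word_eval_closed[OF g] by (simp add: free_group_def)
  next
    case (Cons a u)
    have "fst ` set (foldr push u v) \<subseteq> X"
      using set_foldr_push[of u v] Cons.prems by fastforce
    moreover have "g (fst a) \<in> carrier G" using g Cons.prems by auto
    ultimately show ?case
      using Cons word_eval_closed[OF g, of u] word_eval_closed[OF g, of v]
      by (simp add: free_group_def word_eval_push[OF g] m_assoc)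
  qed
qed (use g in \<open>auto simp: free_group_def intro: word_eval_closed\<close>)

lemma word_eval_generator:
  "g \<in> X \<rightarrow> carrier G \<Longrightarrow> x \<in> X \<Longrightarrow> word_eval G g [(x, True)] = g x"
  by (simp add: Pi_iff)

end

lemma word_eval_hom_comp:
  assumes "group G" "group H" "\<psi> \<in> hom G H" "g \<in> X \<rightarrow> carrier G" "fst ` set w \<subseteq> X"
  shows "\<psi> (word_eval G g w) = word_eval H (\<psi> \<circ> g) w"
proof -
  interpret group_hom G H \<psi>
    using assms by (simp add: group_hom_def group_hom_axioms_def)
  show ?thesis
    using assms(5)
  proof (induction w)
    case (Cons a w)
    then have "g (fst a) \<in> carrier G" "word_eval G g w \<in> carrier G"
      using assms(4) G.word_eval_closed[OF assms(4), of w] by auto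
    then show ?case using Cons by simp
  qed simp
qed

lemma word_eval_free_group:
  assumes "w \<in> carrier (free_group X)"
  shows "word_eval (free_group X) (\<lambda>x. [(x, True)]) w = w"
proof -
  interpret group "free_group X" by (rule group_free_group)
  have inv: "inv\<^bsub>free_group X\<^esub> [(x, True)] = [(x, False)]" if "x \<in> X" for x
    using that by (intro inv_equality) (auto simp: free_group_def reduced_def inv_letter_def)
  have "reduced w" "fst ` set w \<subseteq> X" using assms by (auto simp: free_group_def)
  then show ?thesis
  proof (induction w)
    case (Cons a w)
    then have "word_eval (free_group X) (\<lambda>x. [(x, True)]) (a # w) = [a] \<otimes>\<^bsub>free_group X\<^esub> w"
      using inv[of "fst a"] by (cases a) (auto dest: reduced_Cons_D)
    then show ?case using Cons.prems by (simp add: free_group_def push_reduced)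
  qed (simp add: free_group_def)
qed

lemma free_group_hom_unique:
  assumes "group G" "\<psi> \<in> hom (free_group X) G" "w \<in> carrier (free_group X)"
  shows "\<psi> w = word_eval G (\<lambda>x. \<psi> [(x, True)]) w"
proof -
  have "fst ` set w \<subseteq> X" using assms(3) by (simp add: free_group_def)
  then have "\<psi> (word_eval (free_group X) (\<lambda>x. [(x, True)]) w)
      = word_eval G (\<psi> \<circ> (\<lambda>x. [(x, True)])) w"
    using assms group_free_group
    by (intro word_eval_hom_comp[of _ _ _ _ X]) (auto intro: generator_in_free_group)
  then show ?thesis using assms(3) by (simp add: word_eval_free_group o_def)
qed


subsection \<open>Independence of achirality from the type of group elements\<close>

lemma word_image_eq:
  "word_image n G w = (\<lambda>g. word_eval G g w) ` ({1..n} \<rightarrow>\<^sub>E carrier G)"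
  by (auto simp: word_image_def word_map_def)

lemma word_eval_cong:
  "(\<And>x. x \<in> fst ` set w \<Longrightarrow> g x = h x) \<Longrightarrow> word_eval G g w = word_eval G h w"
  by (induction w) auto

lemma word_eval_in_word_image:
  assumes "w \<in> carrier (FG n)" "g \<in> {1..n} \<rightarrow> carrier G"
  shows "word_eval G g w \<in> word_image n G w"
proof -
  have "word_eval G g w = word_eval G (restrict g {1..n}) w"
    using assms(1) by (intro word_eval_cong) (auto simp: free_group_def)
  moreover have "restrict g {1..n} \<in> {1..n} \<rightarrow>\<^sub>E carrier G"
    using assms(2) by auto
  ultimately show ?thesis unfolding word_image_eq by blast
qed

lemma word_image_transfer:
  fixes H :: "('h, 'm) monoid_scheme"
  assumes "group H" and u: "u \<in> carrier (FG n)" and v: "v \<in> carrier (FG n)"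
    and sub: "\<And>G :: 'g :: infinite monoid. group G \<Longrightarrow> word_image n G u \<subseteq> word_image n G v"
  shows "word_image n H u \<subseteq> word_image n H v"
proof
  interpret H: group H by fact
  fix y assume "y \<in> word_image n H u"
  then obtain h where h: "h \<in> {1..n} \<rightarrow> carrier H" and y: "y = word_eval H h u"
    by (auto simp: word_image_eq PiE_def)
  define K where "K = word_eval H h ` carrier (FG n)"
  have Fn: "group (FG n)" by (rule group_free_group)
  interpret E: group_hom "FG n" H "word_eval H h"
    using Fn \<open>group H\<close> H.word_eval_hom[OF h] by (simp add: group_hom_def group_hom_axioms_def)
  have K: "subgroup K H" unfolding K_def by (rule E.img_is_subgroup)
  have "countable K" unfolding K_def by (rule countable_image) simp
  obtain e :: "nat \<Rightarrow> 'g" where e: "inj e"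
    using infinite_countable_subset[OF infinite_UNIV] by auto
  define \<phi> where "\<phi> = e \<circ> to_nat_on K"
  have \<phi>: "inj_on \<phi> K"
    unfolding \<phi>_def using e \<open>countable K\<close> by (intro comp_inj_on) (auto intro: inj_on_subset)
  define \<psi> where "\<psi> = inv_into K \<phi>"
  define G :: "'g monoid" where
    "G = \<lparr>carrier = \<phi> ` K, mult = (\<lambda>a b. \<phi> (\<psi> a \<otimes>\<^bsub>H\<^esub> \<psi> b)), one = \<phi> \<one>\<^bsub>H\<^esub>\<rparr>"
  have \<psi>\<phi>: "\<psi> (\<phi> k) = k" if "k \<in> K" for k using \<phi> that by (simp add: \<psi>_def)
  have mK: "a \<otimes>\<^bsub>H\<^esub> b \<in> K" if "a \<in> K" "b \<in> K" for a b using K that by (rule subgroup.m_closed)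
  have KH: "k \<in> carrier H" if "k \<in> K" for k using subgroup.mem_carrier[OF K that] .
  have oneK: "\<one>\<^bsub>H\<^esub> \<in> K" using K by (rule subgroup.one_closed)
  have G: "group G"
  proof (rule groupI)
    fix x assume "x \<in> carrier G"
    then obtain k where k: "k \<in> K" "x = \<phi> k" by (auto simp: G_def)
    have "inv\<^bsub>H\<^esub> k \<in> K" using subgroup.m_inv_closed[OF K k(1)] .
    then show "\<exists>y \<in> carrier G. y \<otimes>\<^bsub>G\<^esub> x = \<one>\<^bsub>G\<^esub>"
      using k KH by (intro bexI[of _ "\<phi> (inv\<^bsub>H\<^esub> k)"]) (auto simp: G_def \<psi>\<phi>)
  qed (auto simp: G_def \<psi>\<phi> mK oneK KH H.m_assoc)
  have \<psi>hom: "\<psi> \<in> hom G H"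
    by (rule homI) (auto simp: G_def \<psi>\<phi> mK KH)
  have hK: "h x \<in> K" if "x \<in> {1..n}" for x
    using imageI[OF generator_in_free_group[OF that], of "word_eval H h"]
      H.word_eval_generator[OF h that] by (simp only: K_def)
  have \<phi>h: "\<phi> \<circ> h \<in> {1..n} \<rightarrow> carrier G" using hK by (auto simp: G_def)
  have uX: "fst ` set u \<subseteq> {1..n}" and vX: "fst ` set v \<subseteq> {1..n}"
    using u v by (auto simp: free_group_def)
  have "word_eval G (\<phi> \<circ> h) u \<in> word_image n G v"
    using sub[OF G] word_eval_in_word_image[OF u \<phi>h] by blast
  then obtain g where g: "g \<in> {1..n} \<rightarrow> carrier G"
    and eq: "word_eval G (\<phi> \<circ> h) u = word_eval G g v"
    by (auto simp: word_image_eq PiE_def)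
  have "y = word_eval H (\<psi> \<circ> (\<phi> \<circ> h)) u"
    unfolding y using uX hK by (intro word_eval_cong) (auto simp: \<psi>\<phi>)
  also have "\<dots> = word_eval H (\<psi> \<circ> g) v"
    using word_eval_hom_comp[OF G \<open>group H\<close> \<psi>hom \<phi>h uX]
      word_eval_hom_comp[OF G \<open>group H\<close> \<psi>hom g vX] eq by simp
  also have "\<dots> \<in> word_image n H v"
    using g \<psi>hom by (intro word_eval_in_word_image[OF v]) (auto simp: hom_def)
  finally show "y \<in> word_image n H v" .
qed

lemma achiral_all_groups:
  fixes H :: "('h, 'm) monoid_scheme"
  assumes "achiral TYPE('g :: infinite) n w" "w \<in> carrier (FG n)" "group H"
  shows "word_image n H w = word_image n H (inv\<^bsub>FG n\<^esub> w)"
proof -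
  have w': "inv\<^bsub>FG n\<^esub> w \<in> carrier (FG n)"
    using assms(2) by (rule group.inv_closed[OF group_free_group])
  have eq: "word_image n G w = word_image n G (inv\<^bsub>FG n\<^esub> w)" if "group G" for G :: "'g monoid"
    using assms(1) that unfolding achiral_def by blast
  show ?thesis
  proof
    show "word_image n H w \<subseteq> word_image n H (inv\<^bsub>FG n\<^esub> w)"
      by (rule word_image_transfer[where 'g = 'g, OF assms(3,2) w' equalityD1[OF eq]])
    show "word_image n H (inv\<^bsub>FG n\<^esub> w) \<subseteq> word_image n H w"
      by (rule word_image_transfer[where 'g = 'g, OF assms(3) w' assms(2) equalityD2[OF eq]])
  qed
qed

lemma achiral_type_independent:
  assumes "w \<in> carrier (FG n)"
  shows "achiral TYPE('g :: infinite) n w \<longleftrightarrow> achiral TYPE('h :: infinite) n w"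
proof
  assume *: "achiral TYPE('g) n w"
  show "achiral TYPE('h) n w"
    unfolding achiral_def by (intro allI impI achiral_all_groups[OF * assms])
next
  assume *: "achiral TYPE('h) n w"
  show "achiral TYPE('g) n w"
    unfolding achiral_def by (intro allI impI achiral_all_groups[OF * assms])
qed

end

theory Submission
  imports Defs
begin

text \<open>Two endomorphisms that send \<open>w\<close> to \<open>w\<inverse>\<close> compose to one that fixes \<open>w\<close>, and composing an
  endomorphism that fixes \<open>w\<close> with one that inverts it gives one that inverts it. This translates
  between the two conditions in both directions.

  If \<open>w\<close> is a test word and \<open>f\<close> inverts \<open>w\<close>, then \<open>f \<circ> f\<close> fixes \<open>w\<close>, so it is an automorphism.
  Its injectivity and surjectivity pass to its inner and outer factor, which are both \<open>f\<close>.

  Conversely, suppose that \<open>w\<close> is achiral and that every endomorphism inverting \<open>w\<close> is an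
  automorphism. Achirality, tested in the free group itself, provides at least one endomorphism
  \<open>f\<close> that inverts \<open>w\<close> (lemma \<open>achiral_imp_End_inv_nonempty\<close>). If \<open>\<sigma>\<close> fixes \<open>w\<close>, then \<open>f\<close> and
  \<open>f \<circ> \<sigma>\<close> both invert \<open>w\<close>, so both are automorphisms, and so is \<open>\<sigma> = f\<inverse> \<circ> (f \<circ> \<sigma>)\<close>.\<close>

lemma hom_iso_if_square_iso:
  assumes "f \<in> hom G G" "f \<circ> f \<in> iso G G"
  shows "f \<in> iso G G"
proof -
  have maps: "f ` carrier G \<subseteq> carrier G"
    using assms(1) by (auto simp: hom_def)
  have bij: "bij_betw (f \<circ> f) (carrier G) (carrier G)"
    using assms(2) by (simp add: iso_def)
  then have "inj_on f (carrier G)"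
    by (metis bij_betw_imp_inj_on inj_on_imageI2)
  moreover have "carrier G \<subseteq> f ` carrier G"
    using bij_betw_imp_surj_on[OF bij] maps by fastforce
  ultimately show ?thesis
    using assms(1) maps by (auto simp: iso_def bij_betw_def)
qed

lemma hom_iso_if_comp_iso:
  assumes "f \<in> iso G H" "\<sigma> \<in> hom G G" "f \<circ> \<sigma> \<in> iso G H"
  shows "\<sigma> \<in> iso G G"
proof -
  have "bij_betw \<sigma> (carrier G) (carrier G)"
    using assms bij_betw_comp_iff2[of f "carrier G" "carrier H" \<sigma> "carrier G"]
    by (auto simp: iso_def hom_def)
  with assms(2) show ?thesis by (simp add: iso_def)
qed

text \<open>The word \<open>w\<inverse>\<close> is a value of its own word map on the free group, at the tuple of generators.
  For achiral \<open>w\<close> it is therefore also a value of the word map of \<open>w\<close> there, and by the universal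
  property a tuple that attains it is the same as an endomorphism that inverts \<open>w\<close>.\<close>

lemma achiral_imp_End_inv_nonempty:
  assumes "w \<in> achiral_words TYPE('g::infinite) n"
  obtains f where "f \<in> End_inv n w"
proof -
  interpret F: group "FG n" by (rule group_free_group)
  have w: "w \<in> carrier (FG n)" and ach: "achiral TYPE('g) n w"
    using assms by (auto simp: achiral_words_def)
  have w': "inv\<^bsub>FG n\<^esub> w \<in> carrier (FG n)"
    using w by (rule F.inv_closed)
  have "word_eval (FG n) (\<lambda>x. [(x, True)]) (inv\<^bsub>FG n\<^esub> w) \<in> word_image n (FG n) (inv\<^bsub>FG n\<^esub> w)"
    by (intro word_eval_in_word_image w' Pi_I generator_in_free_group)
  then have "inv\<^bsub>FG n\<^esub> w \<in> word_image n (FG n) w"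
    using w' by (simp add: word_eval_free_group achiral_all_groups[OF ach w group_free_group])
  then obtain g where "g \<in> {1..n} \<rightarrow> carrier (FG n)" "inv\<^bsub>FG n\<^esub> w = word_eval (FG n) g w"
    by (auto simp: word_image_eq PiE_def)
  then have "word_eval (FG n) g \<in> End_inv n w"
    using F.word_eval_hom by (simp add: End_inv_def)
  then show thesis by (rule that)
qed

lemma End_inv_comp_End_inv:
  assumes "f \<in> End_inv n w" "h \<in> End_inv n w" "w \<in> carrier (FG n)"
  shows "(f \<circ> h) w = w"
proof -
  interpret group_hom "FG n" "FG n" f
    using assms(1) group_free_group
    by (simp add: End_inv_def group_hom_def group_hom_axioms_def)
  have "f (h w) = inv\<^bsub>FG n\<^esub> (inv\<^bsub>FG n\<^esub> w)"
    using assms(1,2) by (simp only: End_inv_def mem_Collect_eq hom_inv[OF assms(3)])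
  then show ?thesis
    by (simp only: o_apply G.inv_inv[OF assms(3)])
qed

theorem theorem11:
  fixes n :: nat
  assumes "n \<ge> 1"
  shows "test_words n \<inter> achiral_words TYPE('g::infinite) n = D_words TYPE('g) n"
proof (intro equalityI subsetI)
  fix w assume w: "w \<in> test_words n \<inter> achiral_words TYPE('g) n"
  have "f \<in> Aut_inv n w" if f: "f \<in> End_inv n w" for f
  proof -
    have f_hom: "f \<in> hom (FG n) (FG n)"
      using f by (simp add: End_inv_def)
    have "(f \<circ> f) w = w"
      using f w by (intro End_inv_comp_End_inv) (auto simp: test_words_def)
    moreover have "f \<circ> f \<in> hom (FG n) (FG n)"
      using f_hom f_hom by (rule hom_compose)
    ultimately have "f \<circ> f \<in> iso (FG n) (FG n)"
      using w unfolding test_words_def by blast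
    with f_hom have "f \<in> iso (FG n) (FG n)"
      by (rule hom_iso_if_square_iso)
    then show ?thesis
      using f by (simp add: End_inv_def Aut_inv_def)
  qed
  then have "End_inv n w = Aut_inv n w"
    by (auto simp: End_inv_def Aut_inv_def iso_def)
  then show "w \<in> D_words TYPE('g) n"
    using w by (simp add: D_words_def)
next
  fix w assume "w \<in> D_words TYPE('g) n"
  then have ach: "w \<in> achiral_words TYPE('g) n" and eq: "End_inv n w = Aut_inv n w"
    by (auto simp: D_words_def)
  obtain f where f: "f \<in> End_inv n w"
    using achiral_imp_End_inv_nonempty[OF ach] .
  have "\<sigma> \<in> iso (FG n) (FG n)" if \<sigma>: "\<sigma> \<in> hom (FG n) (FG n)" "\<sigma> w = w" for \<sigma>
  proof -
    have "f \<in> hom (FG n) (FG n)"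
      using f by (simp add: End_inv_def)
    with \<sigma>(1) have "f \<circ> \<sigma> \<in> hom (FG n) (FG n)"
      by (rule hom_compose)
    then have "f \<circ> \<sigma> \<in> End_inv n w"
      using f \<sigma>(2) by (simp add: End_inv_def)
    with f have "f \<in> iso (FG n) (FG n)" "f \<circ> \<sigma> \<in> iso (FG n) (FG n)"
      unfolding eq by (simp_all add: Aut_inv_def)
    with \<sigma>(1) show ?thesis
      by (blast intro: hom_iso_if_comp_iso)
  qed
  then show "w \<in> test_words n \<inter> achiral_words TYPE('g) n"
    using ach by (auto simp: test_words_def achiral_words_def)
qed

end
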